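(* Let $X$ and $Y$ be compact subsets of $\mathbb{R}^n$ and let $c: X\times Y\to\mathbb{R}$ be a measurable cost function which is twice differentiable in the sense that the mixed Hessians $D^2_{xy}c$ and $D^2_{yx}c$ exist and $(D^2_{xy}c)^T = D^2_{yx}c$. Assume that $c$ satisfies: (Twisted) $-D_x c(x,\cdot): Y\to T^*_xX$ is injective for every $x\in X$; (Twisted* ) $-D_y c(\cdot,y): X\to T^*_yY$ is injective for every $y\in Y$; (Non-degenerate) $D^2_{xy}c(x,y)$ is invertible for every $(x,y)\in X\times Y$; (Lip hessian) $D^2_{xy}c$ is Lipschitz on $X\times Y$; ($c$DomConv) $Y^*_x:=-D_xc(x,Y)$ is convex for every $x\in X$; ($c$DomConv* ) $X^*_y:=-D_yc(X,y)$ is convex for every $y\in Y$. If $c$ satisfies Loeper's condition, then $c$ is quantitatively quasi-convex (QQconv).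
   Context: For $x\in X$, the $c$-exponential map $\exp^c_x: Y^*_x\to Y$ is the inverse of $-D_xc(x,\cdot)$, i.e. $-D_xc(x,\exp^c_x(p))=p$. For $x_0\in X$, $v_0,v_1\in Y^*_{x_0}$, $t\in[0,1]$, set $v_t=(1-t)v_0+tv_1$ and $f_t(x)=-c(x,\exp^c_{x_0}(v_t))+c(x_0,\exp^c_{x_0}(v_t))$. Loeper's condition: $f_t(x)\le\max\{f_1(x),f_0(x)\}$ for all $x,x_0\in X$, all $v_0,v_1\in Y^*_{x_0}$ and all $t\in[0,1]$. QQconv: there exists a constant $M\ge 1$ such that $f_t(x)-f_0(x)\le Mt\,(f_1(x)-f_0(x))_+$ for all $x,x_0\in X$, all $v_0,v_1\in Y^*_{x_0}$ and all $t\in[0,1]$, where $a_+=\max\{a,0\}$. *)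

theory Defs
  imports "HOL-Analysis.Analysis"
begin

text \<open>Cost c on R^n x R^n (points of X and Y are vectors in real^'n).
  Dx x y is the gradient in x of c(.,y) at x (identified with the covector -D_x c via
  the Euclidean inner product); Dy x y is the gradient in y.\<close>

definition cexp :: "('a \<Rightarrow> 'm \<Rightarrow> real^'n::finite) \<Rightarrow> 'm set \<Rightarrow> 'a \<Rightarrow> real^'n \<Rightarrow> 'm"
  where "cexp Dx Y x p = the_inv_into Y (\<lambda>y. - Dx x y) p"

definition f_t :: "('a \<Rightarrow> 'm \<Rightarrow> real) \<Rightarrow> ('a \<Rightarrow> 'm \<Rightarrow> real^'n::finite) \<Rightarrow> 'm set
    \<Rightarrow> 'a \<Rightarrow> real^'n \<Rightarrow> real^'n \<Rightarrow> real \<Rightarrow> 'a \<Rightarrow> real"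
  where "f_t c Dx Y x0 v0 v1 t x =
    (let y = cexp Dx Y x0 ((1 - t) *\<^sub>R v0 + t *\<^sub>R v1)
     in - c x y + c x0 y)"

definition loeper :: "('a \<Rightarrow> 'm \<Rightarrow> real) \<Rightarrow> ('a \<Rightarrow> 'm \<Rightarrow> real^'n::finite) \<Rightarrow> 'a set \<Rightarrow> 'm set \<Rightarrow> bool"
  where "loeper c Dx X Y \<longleftrightarrow>
    (\<forall>x\<in>X. \<forall>x0\<in>X. \<forall>v0\<in>(\<lambda>y. - Dx x0 y) ` Y. \<forall>v1\<in>(\<lambda>y. - Dx x0 y) ` Y. \<forall>t\<in>{0..1}.
      f_t c Dx Y x0 v0 v1 t x \<le> max (f_t c Dx Y x0 v0 v1 1 x) (f_t c Dx Y x0 v0 v1 0 x))"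

definition QQconv :: "('a \<Rightarrow> 'm \<Rightarrow> real) \<Rightarrow> ('a \<Rightarrow> 'm \<Rightarrow> real^'n::finite) \<Rightarrow> 'a set \<Rightarrow> 'm set \<Rightarrow> bool"
  where "QQconv c Dx X Y \<longleftrightarrow>
    (\<exists>M\<ge>1. \<forall>x\<in>X. \<forall>x0\<in>X. \<forall>v0\<in>(\<lambda>y. - Dx x0 y) ` Y. \<forall>v1\<in>(\<lambda>y. - Dx x0 y) ` Y. \<forall>t\<in>{0..1}.
      f_t c Dx Y x0 v0 v1 t x - f_t c Dx Y x0 v0 v1 0 x
        \<le> M * t * max (f_t c Dx Y x0 v0 v1 1 x - f_t c Dx Y x0 v0 v1 0 x) 0)"

end

theory Submission
  imports Defs
begin

text \<open>
  Fix \<open>x\<close> and \<open>x\<^sub>0\<close>, and let \<open>F v = - c(x, y) + c(x\<^sub>0, y)\<close> with \<open>y = exp\<^sup>c\<^sub>x\<^sub>0 v\<close>, a function on the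
  convex set \<open>V = Y\<^sup>*\<^sub>x\<^sub>0\<close>. Loeper's condition says that \<open>F\<close> is quasiconvex. Let \<open>G v\<close> be the
  projection of the gradient of \<open>F\<close> to the direction space of \<open>V\<close>.

  The mean value theorem along the segment of \<open>X\<^sup>*\<^sub>y\<close> from \<open>x\<^sub>0\<close> to \<open>x\<close> and the Lipschitz bound on the
  mixed Hessian give \<open>|G u - G v| \<le> K |u - v| |G v|\<close>, where \<open>K\<close> depends only on the cost. The
  bound is relative to \<open>|G v|\<close>, which takes the place of a lower bound on the gradient and covers
  sets \<open>X\<close> and \<open>Y\<close> with empty interior.

  A quasiconvex function with this property satisfies \<open>h'' \<ge> - C |h'|\<close> along segments, in a discrete
  sense: the second derivative is nonnegative along the level sets, and the remaining component of
  the direction is proportional to \<open>h'\<close>. So a positive slope decays at most by a constant factor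
  along the rest of the segment. Comparing the mean slopes on \<open>[0, t]\<close> and \<open>[t, 1]\<close> gives the claim.
\<close>

section \<open>Direction spaces\<close>

text \<open>For nonempty \<open>V\<close>, the linear space parallel to the affine hull. A gradient
  within a convex \<open>V\<close> is determined only up to its orthogonal complement.\<close>

definition direction_space :: "'a::real_vector set \<Rightarrow> 'a set"
  where "direction_space V = span {u - v | u v. u \<in> V \<and> v \<in> V}"

lemma diff_in_direction_space: "u \<in> V \<Longrightarrow> v \<in> V \<Longrightarrow> u - v \<in> direction_space V"
  unfolding direction_space_def by (rule span_base) blast

lemma direction_space_eq_span_at:
  assumes "v \<in> V"
  shows "direction_space V = span ((\<lambda>u. u - v) ` V)"
proof (rule antisym)
  have "x \<in> span ((\<lambda>u. u - v) ` V)" if "x \<in> {u - w | u w. u \<in> V \<and> w \<in> V}" for x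
  proof -
    from that obtain u w where uw: "u \<in> V" "w \<in> V" "x = (u - v) - (w - v)"
      by auto
    show ?thesis
      unfolding uw(3) by (intro span_diff span_base imageI uw(1,2))
  qed
  then show "direction_space V \<subseteq> span ((\<lambda>u. u - v) ` V)"
    unfolding direction_space_def by (meson span_minimal subspace_span subsetI)
  show "span ((\<lambda>u. u - v) ` V) \<subseteq> direction_space V"
    unfolding direction_space_def by (rule span_mono) (use assms in auto)
qed

lemma subspace_direction_space: "subspace (direction_space V)"
  by (simp add: direction_space_def)

lemma add_direction_in_affine_hull:
  assumes "v \<in> V" "d \<in> direction_space V"
  shows "v + d \<in> affine hull V"
  using assms diffs_affine_hull_span[OF assms(1)] direction_space_eq_span_at[OF assms(1)]
  by (auto simp: image_iff algebra_simps set_eq_iff)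

text \<open>For \<open>u\<close> in \<open>V\<close> the image of the segment from \<open>v\<close>
  to \<open>u\<close> stays in \<open>W\<close>, so its component orthogonal to the directions of
  \<open>W\<close> is constant and has zero derivative. The vectors \<open>u - v\<close> span the
  directions of \<open>V\<close>.\<close>

lemma has_derivative_maps_direction_space:
  fixes f :: "'a::real_normed_vector \<Rightarrow> 'b::euclidean_space"
  assumes V: "convex V" "v \<in> V" and f': "(f has_derivative f') (at v within V)"
    and fV: "f ` V \<subseteq> W" and w: "w \<in> direction_space V"
  shows "f' w \<in> direction_space W"
proof -
  have lin: "linear f'" using f' has_derivative_linear by blast
  have base: "f' (u - v) \<in> direction_space W" if u: "u \<in> V" for u
  proof -
    obtain y z where yz: "y \<in> direction_space W" "\<And>w. w \<in> direction_space W \<Longrightarrow> orthogonal z w"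
      "f' (u - v) = y + z"
      unfolding direction_space_def
      using orthogonal_subspace_decomp_exists[of "{u - v |u v. u \<in> W \<and> v \<in> W}" "f' (u - v)"] by blast
    have seg: "v + s *\<^sub>R (u - v) \<in> V" if "s \<in> {0..1}" for s
      using convexD_alt[OF V u, of s] that by (simp add: algebra_simps)
    have 1: "((\<lambda>s. v + s *\<^sub>R (u - v)) has_derivative (\<lambda>h. h *\<^sub>R (u - v))) (at 0 within {0..1::real})"
      by (auto intro!: derivative_eq_intros)
    have 2: "(f has_derivative f') (at (v + 0 *\<^sub>R (u - v)) within (\<lambda>s. v + s *\<^sub>R (u - v)) ` {0..1})"
      using f' seg by (auto intro: has_derivative_subset)
    have 3: "((\<lambda>s. z \<bullet> f (v + s *\<^sub>R (u - v))) has_derivative (\<lambda>h. z \<bullet> f' (h *\<^sub>R (u - v)))) (at 0 within {0..1})"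
      by (rule has_derivative_inner_right[OF has_derivative_in_compose[OF 1 2]])
    have 4: "((\<lambda>s. z \<bullet> f (v + s *\<^sub>R (u - v))) has_vector_derivative (z \<bullet> f' (u - v))) (at 0 within {0..1})"
      using 3 unfolding has_vector_derivative_def by (simp add: linear_scale[OF lin])
    have const: "z \<bullet> f (v + s *\<^sub>R (u - v)) = z \<bullet> f v" if "s \<in> {0..1}" for s
    proof -
      have "f (v + s *\<^sub>R (u - v)) - f v \<in> direction_space W"
        using fV seg[OF that] V(2) by (intro diff_in_direction_space) auto
      from yz(2)[OF this] show ?thesis by (simp add: orthogonal_def inner_diff_right)
    qed
    have "((\<lambda>s. z \<bullet> f v) has_vector_derivative 0) (at 0 within {0..1::real})"
      by simp
    then have 5: "((\<lambda>s. z \<bullet> f (v + s *\<^sub>R (u - v))) has_vector_derivative 0) (at 0 within {0..1})"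
      by (rule has_vector_derivative_transform[rotated 2]) (auto simp: const)
    \<comment> \<open>One-sided derivatives at \<open>0\<close> within \<open>{0..1}\<close> are
      unique. Since \<open>f' (u - v) = y + z\<close> with \<open>y\<close> orthogonal to
      \<open>z\<close>, the left side is the squared norm of \<open>z\<close>.\<close>
    have "z \<bullet> f' (u - v) = 0"
      by (rule vector_derivative_unique_within[OF _ 4 5]) (simp add: trivial_limit_within islimpt_Icc)
    then have "z = 0"
      using yz by (simp add: orthogonal_def inner_add_right)
    then show ?thesis using yz by simp
  qed
  have "f' ` span ((\<lambda>u. u - v) ` V) = span (f' ` (\<lambda>u. u - v) ` V)"
    by (rule linear_span_image[OF lin, symmetric])
  also have "\<dots> \<subseteq> direction_space W"
    using base by (intro span_minimal subspace_direction_space) auto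
  finally show ?thesis
    using w unfolding direction_space_eq_span_at[OF V(2)] by auto
qed

text \<open>A derivative within \<open>V\<close> is tested on the differences \<open>u - v\<close>
  alone. This permits replacing a gradient by its tangential projection.\<close>

lemma has_derivative_within_cong_directions:
  assumes "(f has_derivative f') (at v within V)" "bounded_linear f''" "v \<in> V"
    and "\<And>w. w \<in> direction_space V \<Longrightarrow> f'' w = f' w"
  shows "(f has_derivative f'') (at v within V)"
proof -
  have "f'' (u - v) = f' (u - v)" if "u \<in> V" for u
    using assms(3,4) that by (simp add: diff_in_direction_space)
  then show ?thesis
    using assms(1,2) unfolding has_derivative_within_alt by (metis (no_types, lifting))
qed

section \<open>Quasiconvex functions with a controlled gradient\<close>

lemma has_real_derivative_along_segment:
  fixes F :: "'a::real_inner \<Rightarrow> real"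
  assumes "(F has_derivative (\<lambda>h. g \<bullet> h)) (at (v + t *\<^sub>R w) within V)"
    and "\<And>s. s \<in> S \<Longrightarrow> v + s *\<^sub>R w \<in> V"
  shows "((\<lambda>s. F (v + s *\<^sub>R w)) has_real_derivative (g \<bullet> w)) (at t within S)"
proof -
  have 1: "((\<lambda>s. v + s *\<^sub>R w) has_derivative (\<lambda>h. h *\<^sub>R w)) (at t within S)"
    by (auto intro!: derivative_eq_intros)
  have 2: "(F has_derivative (\<lambda>h. g \<bullet> h)) (at (v + t *\<^sub>R w) within (\<lambda>s. v + s *\<^sub>R w) ` S)"
    using assms by (auto intro: has_derivative_subset)
  show ?thesis
    using has_derivative_in_compose[OF 1 2] unfolding has_field_derivative_def
    by (rule has_derivative_eq_rhs) (auto simp: fun_eq_iff)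
qed

text \<open>What is kept of the cost for one pair \<open>x\<close>, \<open>x0\<close>.
  \<open>tangent\<close> singles out one gradient among those that represent the derivative;
  \<open>K\<close> and \<open>R\<close> are parameters because the final constant may depend on
  nothing else.\<close>

locale gradient_controlled_quasiconvex =
  fixes V :: "'a::euclidean_space set" and F :: "'a \<Rightarrow> real" and G :: "'a \<Rightarrow> 'a" and K R :: real
  assumes convex: "convex V"
    and derivative: "v \<in> V \<Longrightarrow> (F has_derivative (\<lambda>h. G v \<bullet> h)) (at v within V)"
    and tangent: "v \<in> V \<Longrightarrow> G v \<in> direction_space V"
    and control: "u \<in> V \<Longrightarrow> v \<in> V \<Longrightarrow> norm (G u - G v) \<le> K * norm (u - v) * norm (G v)"
    and quasiconvex: "u \<in> V \<Longrightarrow> v \<in> V \<Longrightarrow> t \<in> {0..1} \<Longrightarrow>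
      F ((1 - t) *\<^sub>R u + t *\<^sub>R v) \<le> max (F u) (F v)"
    and K_nonneg: "0 \<le> K"
    and diameter: "u \<in> V \<Longrightarrow> v \<in> V \<Longrightarrow> norm (u - v) \<le> R"
begin

lemma segment_in: "u \<in> V \<Longrightarrow> v \<in> V \<Longrightarrow> t \<in> {0..1} \<Longrightarrow> u + t *\<^sub>R (v - u) \<in> V"
  using convexD_alt[OF convex, of u v t] by (simp add: algebra_simps)

lemma quasiconvex':
  "u \<in> V \<Longrightarrow> v \<in> V \<Longrightarrow> t \<in> {0..1} \<Longrightarrow> F (u + t *\<^sub>R (v - u)) \<le> max (F u) (F v)"
  using quasiconvex[of u v t] by (simp add: algebra_simps)

text \<open>First-order form of quasiconvexity: if \<open>F u \<le> F v\<close>, then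
  \<open>F\<close> is at most \<open>F v\<close> on the whole segment, against the positive
  derivative at \<open>v\<close>.\<close>

lemma increase_if_gradient_pos:
  assumes "u \<in> V" "v \<in> V" and pos: "G v \<bullet> (u - v) > 0"
  shows "F v < F u"
proof (rule ccontr)
  assume "\<not> F v < F u"
  then have le: "F (v + t *\<^sub>R (u - v)) \<le> F v" if "t \<in> {0..1}" for t
    using quasiconvex'[OF assms(2,1) that] by linarith
  have "((\<lambda>s. F (v + s *\<^sub>R (u - v))) has_real_derivative (G v \<bullet> (u - v))) (at 0 within {0..1})"
    using derivative[OF assms(2)] segment_in[OF assms(2,1)]
    by (intro has_real_derivative_along_segment[where V=V]) auto
  from has_real_derivative_pos_inc_right[OF this pos]
  obtain d where d: "d > 0" "\<And>h. h > 0 \<Longrightarrow> h \<in> {0..1} \<Longrightarrow> h < d \<Longrightarrow> F v < F (v + h *\<^sub>R (u - v))"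
    by auto
  show False
    using d(1) d(2)[of "min (d/2) 1"] le[of "min (d/2) 1"] by (auto simp: min_less_iff_disj)
qed

section \<open>Decay of a positive slope along a segment\<close>

text \<open>Relative loss of slope per unit of step length in \<open>slope_step\<close>:
  \<open>1\<close> from shortening the normal component by the factor \<open>1 - e\<close>,
  \<open>K * R\<close> from the change of the gradient along \<open>G v\<close>, the rest from
  comparing gradients at the ends of \<open>e *\<^sub>R d\<close> and
  \<open>e *\<^sub>R w\<close>.\<close>

definition "decay = 1 + K * R + 2 * K * R * (1 + K * R)"

text \<open>The comparison direction \<^term>\<open>d\<close> is, up to a correction of order \<^term>\<open>e\<close> that keeps
  \<^term>\<open>F\<close> strictly increasing along it, the component of \<^term>\<open>w\<close> tangent to the level set
  of \<^term>\<open>F\<close> through \<^term>\<open>v\<close>.\<close>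

lemma slope_step:
  assumes v: "v \<in> V" and vw: "v + e *\<^sub>R w \<in> V" and w: "w \<in> direction_space V" "norm w \<le> R"
    and e: "0 < e" "e \<le> 1"
    and room: "\<And>d. d \<in> direction_space V \<Longrightarrow> norm d \<le> 2 * e * norm w \<Longrightarrow> v + d \<in> V"
    and pos: "G v \<bullet> w > 0"
  shows "G (v + e *\<^sub>R w) \<bullet> w \<ge> (1 - decay * e) * (G v \<bullet> w)"
proof -
  define g where "g = norm (G v)"
  \<comment> \<open>\<open>l *\<^sub>R G v\<close> is the component of \<open>w\<close> along the
    gradient. The factor \<open>1 - e\<close> in \<open>m\<close> leaves
    \<open>G v \<bullet> d = e * (G v \<bullet> w)\<close>, which is strictly positive.\<close>
  define l where "l = (G v \<bullet> w) / g\<^sup>2"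
  define m where "m = l * (1 - e)"
  define d where "d = w - m *\<^sub>R G v"
  have g: "g > 0" using pos by (auto simp: g_def)
  have l: "l > 0" using pos g by (simp add: l_def)
  have lg2: "l * g\<^sup>2 = G v \<bullet> w" using g by (simp add: l_def)
  have GG: "G v \<bullet> G v = g\<^sup>2" by (simp add: g_def power2_norm_eq_inner)
  have m: "0 \<le> m" "m \<le> l" using l e by (simp_all add: m_def mult_left_le)
  have R: "0 \<le> R" using w(2) norm_ge_zero order_trans by blast
  have "l * g * g \<le> norm w * g"
    using norm_cauchy_schwarz[of "G v" w] lg2 by (simp add: g_def power2_eq_square mult.commute mult.left_commute)
  then have lg: "l * g \<le> norm w" using g by simp
  have mg: "m * g \<le> norm w" using m lg g by (meson mult_right_mono less_imp_le order_trans)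
  have "norm d \<le> norm w + norm (m *\<^sub>R G v)"
    unfolding d_def by (rule norm_triangle_ineq4)
  also have "\<dots> \<le> 2 * norm w" using mg m by (simp add: g_def)
  finally have nd: "norm d \<le> 2 * norm w" .
  have dT: "d \<in> direction_space V"
    unfolding d_def using w tangent[OF v] subspace_direction_space
    by (intro subspace_diff subspace_scale) auto
  have vd: "v + e *\<^sub>R d \<in> V"
    using dT nd e by (intro room subspace_scale subspace_direction_space) auto
  have "G v \<bullet> d = e * (l * g\<^sup>2)"
    unfolding d_def m_def inner_diff_right inner_scaleR_right GG lg2[symmetric] by (simp add: algebra_simps)
  then have "G v \<bullet> d > 0" using e l g by simp
  \<comment> \<open>Quasiconvexity enters twice: \<open>v + e *\<^sub>R d\<close> lies strictly
    higher than \<open>v\<close>, hence the gradient there cannot point back towards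
    \<open>v\<close>, which gives \<open>d0\<close>.\<close>
  then have "F v < F (v + e *\<^sub>R d)"
    using e by (intro increase_if_gradient_pos[OF vd v]) auto
  then have "\<not> G (v + e *\<^sub>R d) \<bullet> (v - (v + e *\<^sub>R d)) > 0"
    using increase_if_gradient_pos[OF v vd] by fastforce
  then have d0: "G (v + e *\<^sub>R d) \<bullet> d \<ge> 0"
    using e by (simp add: not_less zero_le_mult_iff)
  let ?G = "G (v + e *\<^sub>R w)"
  have ctrl: "norm (?G - G v) \<le> K * R * e * g"
  proof -
    have "norm (?G - G v) \<le> K * norm (e *\<^sub>R w) * g"
      using control[OF vw v] by (simp add: g_def)
    also have "\<dots> \<le> K * (R * e) * g"
      using w(2) e g K_nonneg by (intro mult_right_mono mult_left_mono) (auto simp: mult.commute)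
    finally show ?thesis by (simp add: mult.assoc)
  qed
  have nG: "norm ?G \<le> (1 + K * R) * g"
  proof -
    have "norm ?G \<le> norm (?G - G v) + g"
      unfolding g_def by (metis add.commute norm_triangle_sub)
    also have "K * R * e * g \<le> K * R * g"
      using K_nonneg R e g by (intro mult_right_mono) (auto simp: mult_left_le)
    ultimately show ?thesis using ctrl g by (simp add: algebra_simps)
  qed
  \<comment> \<open>The two points differ by \<open>e * m\<close> times \<open>G v\<close>, so the
    error carries the factor \<open>l * g\<^sup>2 = G v \<bullet> w\<close>: the loss is relative to
    the slope itself.\<close>
  have "(G (v + e *\<^sub>R d) - ?G) \<bullet> d \<le> 2 * K * R * (1 + K * R) * e * (l * g\<^sup>2)"
  proof -
    have "norm (G (v + e *\<^sub>R d) - ?G) \<le> K * norm ((v + e *\<^sub>R d) - (v + e *\<^sub>R w)) * norm ?G"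
      by (rule control[OF vd vw])
    also have "(v + e *\<^sub>R d) - (v + e *\<^sub>R w) = - (e * m) *\<^sub>R G v"
      by (simp add: d_def algebra_simps)
    also have "K * norm (- (e * m) *\<^sub>R G v) * norm ?G = K * (e * m * g) * norm ?G"
      using e m by (simp add: g_def)
    also have "\<dots> \<le> K * (e * l * g) * ((1 + K * R) * g)"
      using nG e m g K_nonneg l by (intro mult_mono mult_left_mono) (auto intro!: mult_right_mono mult_left_mono)
    finally have "norm (G (v + e *\<^sub>R d) - ?G) \<le> K * (e * l * g) * ((1 + K * R) * g)" .
    moreover have "norm d \<le> 2 * R" using nd w(2) by simp
    ultimately have "norm (G (v + e *\<^sub>R d) - ?G) * norm d \<le> (K * (e * l * g) * ((1 + K * R) * g)) * (2 * R)"
      using K_nonneg e l g R by (intro mult_mono) auto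
    also have "\<dots> = 2 * K * R * (1 + K * R) * e * (l * g\<^sup>2)"
      by (simp add: power2_eq_square algebra_simps)
    finally show ?thesis
      using norm_cauchy_schwarz[of "G (v + e *\<^sub>R d) - ?G" d] by linarith
  qed
  then have A: "?G \<bullet> d \<ge> - (2 * K * R * (1 + K * R) * e * (l * g\<^sup>2))"
    using d0 by (simp add: inner_diff_left)
  have "(G v - ?G) \<bullet> G v \<le> K * R * e * g * g"
  proof -
    have "(G v - ?G) \<bullet> G v \<le> norm (?G - G v) * g"
      using norm_cauchy_schwarz[of "G v - ?G" "G v"] by (simp add: g_def norm_minus_commute)
    also have "\<dots> \<le> K * R * e * g * g"
      using ctrl g by (intro mult_right_mono) auto
    finally show ?thesis .
  qed
  then have "?G \<bullet> G v \<ge> g\<^sup>2 * (1 - K * R * e)"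
    by (simp add: inner_diff_left GG power2_eq_square algebra_simps)
  then have "m * (?G \<bullet> G v) \<ge> m * (g\<^sup>2 * (1 - K * R * e))"
    using m by (intro mult_left_mono)
  also have "m * (g\<^sup>2 * (1 - K * R * e)) = (l * g\<^sup>2) * ((1 - e) * (1 - K * R * e))"
    by (simp add: m_def)
  also have "(l * g\<^sup>2) * (1 - e - K * R * e) \<le> (l * g\<^sup>2) * ((1 - e) * (1 - K * R * e))"
    using l g K_nonneg R e by (intro mult_left_mono) (auto simp: algebra_simps)
  finally (xtrans) have B: "m * (?G \<bullet> G v) \<ge> (l * g\<^sup>2) * (1 - e - K * R * e)" .
  have "?G \<bullet> w = ?G \<bullet> d + m * (?G \<bullet> G v)"
    by (simp add: d_def inner_diff_right)
  also have "\<dots> \<ge> - (2 * K * R * (1 + K * R) * e * (l * g\<^sup>2)) + (l * g\<^sup>2) * (1 - e - K * R * e)"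
    using A B by linarith
  finally (xtrans) show ?thesis
    unfolding lg2 decay_def by (simp add: algebra_simps)
qed

text \<open>\<open>slope_step\<close> is iterated over \<open>N\<close> equal steps from
  \<open>t\<close> to \<open>s\<close>. The radius \<open>r\<close> affects only the number of
  steps, not the resulting bound.\<close>

lemma slope_decay:
  assumes v0: "v0 \<in> V" and v1: "v1 \<in> V" and r: "r > 0"
    and room: "\<And>d. d \<in> direction_space V \<Longrightarrow> norm d < r \<Longrightarrow> v0 + d \<in> V \<and> v1 + d \<in> V"
    and ts: "0 \<le> t" "t < s" "s \<le> 1"
    and pos: "G (v0 + t *\<^sub>R (v1 - v0)) \<bullet> (v1 - v0) > 0"
  shows "G (v0 + s *\<^sub>R (v1 - v0)) \<bullet> (v1 - v0)
    \<ge> exp (- 2 * decay) * (G (v0 + t *\<^sub>R (v1 - v0)) \<bullet> (v1 - v0))"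
proof -
  define w where "w = v1 - v0"
  have R: "0 \<le> R" using diameter[OF v0 v0] by simp
  have decay: "decay \<ge> 1" using K_nonneg R by (simp add: decay_def)
  \<comment> \<open>The first lower bound keeps the comparison directions within the radius
    \<open>r\<close>; the second gives \<open>decay * e \<le> 1 / 2\<close>, where
    \<open>1 - x\<close> dominates \<open>exp (- 2 * x)\<close>.\<close>
  obtain N :: nat where N: "real N > max (2 * R / r) (2 * decay)"
    using reals_Archimedean2 by blast
  then have N0: "N > 0" "real N \<ge> 1" using decay by auto
  define e where "e = (s - t) / N"
  have e: "0 < e" "e \<le> 1 / N" using ts N0 by (auto simp: e_def divide_right_mono)
  have e1: "e \<le> 1" using e(2) N0 by (meson divide_le_eq_1 order_trans of_nat_0_less_iff)
  have De: "decay * e \<le> 1 / 2"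
  proof -
    have "decay * e \<le> decay * (1 / N)" using e decay by (intro mult_left_mono) auto
    also have "\<dots> \<le> 1 / 2" using N N0 by (simp add: field_simps)
    finally show ?thesis .
  qed
  have eR: "2 * e * R < r"
  proof -
    have "2 * e * R \<le> 2 * (1 / N) * R" using e R by (intro mult_right_mono) auto
    also have "\<dots> < r" using N N0 r by (simp add: field_simps)
    finally show ?thesis .
  qed
  have w: "w \<in> direction_space V" "norm w \<le> R"
    using diff_in_direction_space[OF v1 v0] diameter[OF v1 v0] by (simp_all add: w_def)
  \<comment> \<open>Shifting both endpoints by \<open>d\<close> shifts the segment by
    \<open>d\<close>, so convexity carries the room at the endpoints to every point between.\<close>
  have room': "(v0 + x *\<^sub>R w) + d \<in> V"
    if "x \<in> {0..1}" "d \<in> direction_space V" "norm d \<le> 2 * e * norm w" for x d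
  proof -
    have "2 * e * norm w \<le> 2 * e * R" using e w by (intro mult_left_mono) auto
    then have "norm d < r" using that(3) eR by linarith
    then have "(v0 + d) + x *\<^sub>R ((v1 + d) - (v0 + d)) \<in> V"
      using room that by (intro segment_in) auto
    then show ?thesis by (simp add: w_def algebra_simps)
  qed
  have seg: "v0 + x *\<^sub>R w \<in> V" if "x \<in> {0..1}" for x
    using segment_in[OF v0 v1 that] by (simp add: w_def)
  define p where "p k = G (v0 + (t + real k * e) *\<^sub>R w) \<bullet> w" for k
  have p0: "p 0 > 0" using pos by (simp add: p_def w_def)
  have "p k \<ge> (1 - decay * e) ^ k * p 0" if "k \<le> N" for k
    using that
  proof (induction k)
    case (Suc k)
    have in01: "t + real j * e \<in> {0..1}" if "j \<le> N" for j
    proof -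
      have "real j * e \<le> real N * e" using that e by (intro mult_right_mono) auto
      also have "\<dots> = s - t" using N0 by (simp add: e_def)
      finally show ?thesis using ts e by auto
    qed
    have IH: "p k \<ge> (1 - decay * e) ^ k * p 0" using Suc by simp
    moreover have "(1 - decay * e) ^ k * p 0 > 0" using De p0 by simp
    ultimately have pk: "p k > 0" by linarith
    have eq: "(v0 + (t + real k * e) *\<^sub>R w) + e *\<^sub>R w = v0 + (t + real (Suc k) * e) *\<^sub>R w"
      by (simp add: algebra_simps)
    have "(1 - decay * e) * p k \<le> G ((v0 + (t + real k * e) *\<^sub>R w) + e *\<^sub>R w) \<bullet> w"
      unfolding p_def
    proof (rule slope_step)
      show "v0 + (t + real k * e) *\<^sub>R w \<in> V" using Suc.prems by (intro seg in01) auto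
      show "v0 + (t + real k * e) *\<^sub>R w + e *\<^sub>R w \<in> V"
        unfolding eq using Suc.prems by (intro seg in01) auto
      show "v0 + (t + real k * e) *\<^sub>R w + d \<in> V"
        if "d \<in> direction_space V" "norm d \<le> 2 * e * norm w" for d
        using Suc.prems that by (intro room' in01) auto
      show "0 < G (v0 + (t + real k * e) *\<^sub>R w) \<bullet> w" using pk by (simp add: p_def)
    qed (use w e e1 in auto)
    then have "(1 - decay * e) * p k \<le> p (Suc k)"
      unfolding eq by (simp add: p_def)
    moreover have "(1 - decay * e) * ((1 - decay * e) ^ k * p 0) \<le> (1 - decay * e) * p k"
      using IH De by (intro mult_left_mono) auto
    ultimately show ?case by simp
  qed simp
  then have pN: "p N \<ge> (1 - decay * e) ^ N * p 0" by simp
  have "exp (- 2 * x) \<le> 1 - x" if "0 \<le> x" "x \<le> 1 / 2" for x :: real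
  proof -
    have "0 \<le> x * (1 - 2 * x)" using that by simp
    then have "1 \<le> (1 - x) * (1 + 2 * x)" by (simp add: algebra_simps)
    also have "\<dots> \<le> (1 - x) * exp (2 * x)"
      using that by (intro mult_left_mono exp_ge_add_one_self) auto
    finally show ?thesis by (simp add: exp_minus field_simps)
  qed
  then have "exp (- 2 * (decay * e)) ^ N \<le> (1 - decay * e) ^ N"
    using De decay e by (intro power_mono) auto
  moreover have "exp (- 2 * decay) \<le> exp (- 2 * (decay * e)) ^ N"
  proof -
    have "real N * e = s - t" using N0 by (simp add: e_def)
    then have "decay * (real N * e) \<le> decay * 1" using ts decay by (intro mult_left_mono) auto
    then show ?thesis by (simp add: exp_of_nat_mult[symmetric] algebra_simps)
  qed
  ultimately have "exp (- 2 * decay) * p 0 \<le> (1 - decay * e) ^ N * p 0"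
    using p0 by (intro mult_right_mono) auto
  then have "exp (- 2 * decay) * p 0 \<le> p N" using pN by linarith
  moreover have "t + real N * e = s" using N0 by (simp add: e_def)
  ultimately show ?thesis by (simp add: p_def w_def)
qed

section \<open>From slope decay to the quantitative inequality\<close>

text \<open>Endpoints in the relative interior provide the room that \<open>slope_decay\<close>
  demands.\<close>

lemma quantitative_quasiconvexity_interior:
  assumes v0: "v0 \<in> rel_interior V" and v1: "v1 \<in> rel_interior V" and t: "t \<in> {0..1}"
  shows "F (v0 + t *\<^sub>R (v1 - v0)) - F v0 \<le> 2 * exp (2 * decay) * t * max (F v1 - F v0) 0"
proof -
  define h where "h s = F (v0 + s *\<^sub>R (v1 - v0))" for s
  define M where "M = 2 * exp (2 * decay)"
  have vV: "v0 \<in> V" "v1 \<in> V" using v0 v1 rel_interior_subset by auto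
  have h01: "h 0 = F v0" "h 1 = F v1" by (simp_all add: h_def)
  have R: "0 \<le> R" using diameter[OF vV(1) vV(1)] by simp
  have M: "M \<ge> 2" using K_nonneg R by (simp add: M_def decay_def)
  have ht: "h t \<le> max (h 0) (h 1)"
    using quasiconvex'[OF vV t] unfolding h01 by (simp add: h_def)
  have t0: "0 \<le> t" "t \<le> 1" using t by auto
  have "h t - h 0 \<le> M * t * max (h 1 - h 0) 0"
  proof (cases "h t \<le> h 0")
    case True
    moreover have "0 \<le> M * t * max (h 1 - h 0) 0" using M t by auto
    ultimately show ?thesis by linarith
  next
    case False
    then have pos: "h t - h 0 > 0" "h t \<le> h 1" using ht by auto
    have tpos: "t > 0" using False t by (cases "t = 0") auto
    \<comment> \<open>The factor 2 in \<open>M\<close> serves both cases: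
      \<open>M * t \<ge> 1\<close> for \<open>t \<ge> 1/2\<close>, where quasiconvexity alone
      suffices, and \<open>1 - t \<ge> 1/2\<close> otherwise, where the mean slopes \<open>a\<close>
      at \<open>x < t\<close> and \<open>b\<close> at \<open>y > t\<close> are compared.\<close>
    show ?thesis
    proof (cases "t \<ge> 1/2")
      case True
      have "h t - h 0 \<le> 1 * (h 1 - h 0)" using pos by simp
      also have "\<dots> \<le> M * t * (h 1 - h 0)"
        using M True pos mult_mono[of 2 M "1/2" t] by (intro mult_right_mono) auto
      finally have "h t - h 0 \<le> M * t * (h 1 - h 0)" .
      then show ?thesis using pos by (simp add: max_def)
    next
      case False
      have der: "(h has_derivative (\<lambda>x. x * (G (v0 + s *\<^sub>R (v1 - v0)) \<bullet> (v1 - v0)))) (at s within {0..1})"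
        if "s \<in> {0..1}" for s
        unfolding h_def
        using has_real_derivative_along_segment[where V=V and S="{0..1}", OF derivative] segment_in[OF vV] that
        by (auto simp: has_field_derivative_def mult.commute[of _ "G _ \<bullet> _"])
      have "\<exists>x\<in>{0<..<t}. h t - h 0 = (t - 0) * (G (v0 + x *\<^sub>R (v1 - v0)) \<bullet> (v1 - v0))"
        using t0 tpos by (intro mvt_simple) (auto intro!: has_derivative_subset[OF der])
      then obtain x where x: "0 < x" "x < t" "h t - h 0 = t * (G (v0 + x *\<^sub>R (v1 - v0)) \<bullet> (v1 - v0))"
        by auto
      have "\<exists>y\<in>{t<..<1}. h 1 - h t = (1 - t) * (G (v0 + y *\<^sub>R (v1 - v0)) \<bullet> (v1 - v0))"
        using t0 tpos False by (intro mvt_simple) (auto intro!: has_derivative_subset[OF der])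
      then obtain y where y: "t < y" "y < 1" "h 1 - h t = (1 - t) * (G (v0 + y *\<^sub>R (v1 - v0)) \<bullet> (v1 - v0))"
        by auto
      obtain r0 where r0: "r0 > 0" "ball v0 r0 \<inter> affine hull V \<subseteq> V"
        using v0 by (auto simp: mem_rel_interior_ball)
      obtain r1 where r1: "r1 > 0" "ball v1 r1 \<inter> affine hull V \<subseteq> V"
        using v1 by (auto simp: mem_rel_interior_ball)
      define a where "a = G (v0 + x *\<^sub>R (v1 - v0)) \<bullet> (v1 - v0)"
      define b where "b = G (v0 + y *\<^sub>R (v1 - v0)) \<bullet> (v1 - v0)"
      have a: "a > 0" using pos(1) x(3) t0 unfolding a_def[symmetric] by (simp add: zero_less_mult_iff)
      have "exp (- 2 * decay) * a \<le> b"
        unfolding a_def b_def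
      proof (rule slope_decay[OF vV, of "min r0 r1"])
        fix d assume d: "d \<in> direction_space V" "norm d < min r0 r1"
        then show "v0 + d \<in> V \<and> v1 + d \<in> V"
          using r0(2) r1(2) add_direction_in_affine_hull[of _ V d] vV by (auto simp: dist_norm subset_iff)
      qed (use r0 r1 x y t0 a in \<open>auto simp: a_def\<close>)
      then have "a \<le> exp (2 * decay) * b" by (simp add: exp_minus field_simps)
      moreover have "b \<le> 2 * (h 1 - h t)"
      proof -
        have "0 \<le> b" using \<open>exp (- 2 * decay) * a \<le> b\<close> a
          by (meson exp_ge_zero less_imp_le mult_nonneg_nonneg order_trans)
        then have "0 \<le> (1 - 2 * t) * b" using False by simp
        then show ?thesis unfolding y(3) b_def[symmetric] by (simp add: algebra_simps)
      qed
      ultimately have "a \<le> exp (2 * decay) * (2 * (h 1 - h t))"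
        by (meson exp_ge_zero mult_left_mono order_trans)
      also have "\<dots> \<le> exp (2 * decay) * (2 * (h 1 - h 0))"
        using pos by (intro mult_left_mono) auto
      finally have "t * a \<le> t * (exp (2 * decay) * (2 * (h 1 - h 0)))"
        using t0 by (intro mult_left_mono)
      then have "h t - h 0 \<le> M * t * (h 1 - h 0)"
        unfolding x(3) a_def[symmetric] M_def by (simp only: ac_simps)
      then show ?thesis using pos by (simp add: max_def)
    qed
  qed
  then show ?thesis unfolding h01 M_def by (simp add: h_def)
qed

text \<open>Both endpoints are contracted towards a point \<open>z\<close> of the relative interior.
  The constant does not depend on the contraction, and \<open>F\<close> is continuous on
  \<open>V\<close>, so the inequality passes to the limit.\<close>

lemma quantitative_quasiconvexity:
  assumes v0: "v0 \<in> V" and v1: "v1 \<in> V" and t: "t \<in> {0..1}"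
  shows "F (v0 + t *\<^sub>R (v1 - v0)) - F v0 \<le> 2 * exp (2 * decay) * t * max (F v1 - F v0) 0"
proof -
  obtain z where z: "z \<in> rel_interior V"
    using rel_interior_eq_empty[OF convex] v0 by auto
  define e where "e n = inverse (real (Suc n))" for n
  have e: "0 < e n" "e n \<le> 1" for n by (auto simp: e_def field_simps)
  have e0: "e \<longlonglongrightarrow> 0" unfolding e_def by (rule LIMSEQ_inverse_real_of_nat)
  define q where "q v n = v - e n *\<^sub>R (v - z)" for v n
  have qi: "q v n \<in> rel_interior V" if "v \<in> V" for v n
    unfolding q_def by (rule rel_interior_convex_shrink[OF convex z that e])
  have contF: "continuous_on V F"
    using has_derivative_continuous[OF derivative] by (auto simp: continuous_on_eq_continuous_within)
  have lim: "(\<lambda>n. F (q v n)) \<longlonglongrightarrow> F v" if "v \<in> V" for v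
  proof (rule continuous_on_tendsto_compose[OF contF _ that])
    have "q v \<longlonglongrightarrow> v - 0 *\<^sub>R (v - z)"
      unfolding q_def by (intro tendsto_intros e0)
    then show "q v \<longlonglongrightarrow> v" by simp
    show "\<forall>\<^sub>F n in sequentially. q v n \<in> V"
      using qi[OF that] rel_interior_subset by (intro always_eventually) blast
  qed
  \<comment> \<open>Contraction is affine, so it preserves the parameter \<open>t\<close>.\<close>
  have eq: "q (v0 + t *\<^sub>R (v1 - v0)) n = q v0 n + t *\<^sub>R (q v1 n - q v0 n)" for n
    by (simp add: q_def algebra_simps)
  show ?thesis
  proof (rule LIMSEQ_le)
    show "(\<lambda>n. F (q (v0 + t *\<^sub>R (v1 - v0)) n) - F (q v0 n)) \<longlonglongrightarrow> F (v0 + t *\<^sub>R (v1 - v0)) - F v0"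
      by (intro tendsto_intros lim segment_in assms)
    show "(\<lambda>n. 2 * exp (2 * decay) * t * max (F (q v1 n) - F (q v0 n)) 0)
        \<longlonglongrightarrow> 2 * exp (2 * decay) * t * max (F v1 - F v0) 0"
      by (intro tendsto_intros lim assms)
    show "\<exists>N. \<forall>n\<ge>N. F (q (v0 + t *\<^sub>R (v1 - v0)) n) - F (q v0 n)
        \<le> 2 * exp (2 * decay) * t * max (F (q v1 n) - F (q v0 n)) 0"
      unfolding eq using quantitative_quasiconvexity_interior[OF qi qi] assms by blast
  qed
qed

end

section \<open>Matrices and inverse maps\<close>

lemma matrix_inv_mult_vector:
  fixes A :: "real^'n^'n"
  assumes "invertible A"
  shows "matrix_inv A *v (A *v x) = x" and "A *v (matrix_inv A *v x) = x"
proof -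
  have "A ** matrix_inv A = mat 1 \<and> matrix_inv A ** A = mat 1"
    using assms unfolding invertible_def matrix_inv_def by (rule someI_ex)
  then show "matrix_inv A *v (A *v x) = x" "A *v (matrix_inv A *v x) = x"
    by (simp_all add: matrix_vector_mul_assoc)
qed

lemma inner_transpose_mult_vector:
  fixes A :: "real^'n^'m"
  shows "(transpose A *v x) \<bullet> y = x \<bullet> (A *v y)"
  by (simp add: transpose_matrix_vector dot_lmul_matrix)

lemma inner_matrix_inv_transpose:
  fixes A :: "real^'n^'n"
  assumes "invertible A"
  shows "(matrix_inv (transpose A) *v p) \<bullet> z = p \<bullet> (matrix_inv A *v z)"
proof -
  have "(matrix_inv (transpose A) *v p) \<bullet> z = (matrix_inv (transpose A) *v p) \<bullet> (A *v (matrix_inv A *v z))"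
    by (simp add: matrix_inv_mult_vector[OF assms])
  also have "\<dots> = (transpose A *v (matrix_inv (transpose A) *v p)) \<bullet> (matrix_inv A *v z)"
    by (rule inner_transpose_mult_vector[symmetric])
  also have "\<dots> = p \<bullet> (matrix_inv A *v z)"
    using assms by (simp only: matrix_inv_mult_vector transpose_invertible)
  finally show ?thesis .
qed

lemma bounded_bilinear_matrix_vector_mult:
  "bounded_bilinear ((*v) :: real^'n^'m \<Rightarrow> real^'n \<Rightarrow> real^'m)"
  unfolding bilinear_conv_bounded_bilinear[symmetric] bilinear_def
  by (auto intro!: linearI simp: matrix_vector_right_distrib matrix_vector_mult_add_rdistrib
      matrix_vector_mult_scaleR simp flip: scaleR_matrix_vector_assoc)

text \<open>\<open>S\<close> may have empty interior: continuity of the inverse comes from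
  compactness of \<open>S\<close>, and the derivative is taken within the image.\<close>

lemma has_derivative_the_inv_into_minus:
  fixes D :: "real^'n \<Rightarrow> real^'n"
  assumes "compact S" and inj: "inj_on (\<lambda>y. - D y) S"
    and der: "\<And>y. y \<in> S \<Longrightarrow> (D has_derivative (\<lambda>h. A y *v h)) (at y)"
    and inv: "invertible (A y)" and y: "y \<in> S"
  shows "(the_inv_into S (\<lambda>y. - D y) has_derivative (\<lambda>h. - (matrix_inv (A y) *v h)))
    (at (- D y) within (\<lambda>y. - D y) ` S)"
proof (rule has_derivative_inverse_within)
  show inv_eq: "the_inv_into S (\<lambda>y. - D y) (- D x) = x" if "x \<in> S" for x
    by (rule the_inv_into_f_f[OF inj that])
  have der': "((\<lambda>y. - D y) has_derivative (\<lambda>h. - (A y *v h))) (at y within S)" if "y \<in> S" for y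
    by (rule has_derivative_minus[OF has_derivative_at_withinI[OF der[OF that]]])
  then show "((\<lambda>y. - D y) has_derivative (\<lambda>h. - (A y *v h))) (at y within S)"
    using y by simp
  have "continuous_on S (\<lambda>y. - D y)"
    using has_derivative_continuous[OF der'] by (simp add: continuous_on_eq_continuous_within)
  then have "continuous_on ((\<lambda>y. - D y) ` S) (the_inv_into S (\<lambda>y. - D y))"
    using assms(1) inv_eq by (intro continuous_on_inv) auto
  then show "continuous (at (- D y) within (\<lambda>y. - D y) ` S) (the_inv_into S (\<lambda>y. - D y))"
    using y by (auto simp: continuous_on_eq_continuous_within)
  show "linear (\<lambda>h. - (matrix_inv (A y) *v h))"
    by (rule linear_compose_neg[OF matrix_vector_mul_linear])
  show "(\<lambda>h. - (matrix_inv (A y) *v h)) \<circ> (\<lambda>h. - (A y *v h)) = id"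
    using inv by (simp add: fun_eq_iff matrix_inv_mult_vector linear_neg[OF matrix_vector_mul_linear])
qed (rule y)

section \<open>Twisted costs\<close>

locale twisted_cost =
  fixes X Y :: "(real^'n) set" and c :: "real^'n \<Rightarrow> real^'n \<Rightarrow> real"
    and Dx Dy :: "real^'n \<Rightarrow> real^'n \<Rightarrow> real^'n" and A :: "real^'n \<Rightarrow> real^'n \<Rightarrow> real^'n^'n"
  assumes compact_X: "compact X" and compact_Y: "compact Y"
    and Dy: "x \<in> X \<Longrightarrow> y \<in> Y \<Longrightarrow> (c x has_derivative (\<lambda>h. Dy x y \<bullet> h)) (at y)"
    and Dxy: "x \<in> X \<Longrightarrow> y \<in> Y \<Longrightarrow> (Dx x has_derivative (\<lambda>h. A x y *v h)) (at y)"
    and Dyx: "x \<in> X \<Longrightarrow> y \<in> Y \<Longrightarrow>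
      ((\<lambda>x'. Dy x' y) has_derivative (\<lambda>h. transpose (A x y) *v h)) (at x)"
    and twisted: "x \<in> X \<Longrightarrow> inj_on (\<lambda>y. - Dx x y) Y"
    and twisted_star: "y \<in> Y \<Longrightarrow> inj_on (\<lambda>x. - Dy x y) X"
    and nondeg: "x \<in> X \<Longrightarrow> y \<in> Y \<Longrightarrow> invertible (A x y)"
    and lipschitz: "\<exists>L. L-lipschitz_on (X \<times> Y) (\<lambda>(x, y). A x y)"
    and cdomconv: "x \<in> X \<Longrightarrow> convex ((\<lambda>y. - Dx x y) ` Y)"
    and cdomconv_star: "y \<in> Y \<Longrightarrow> convex ((\<lambda>x. - Dy x y) ` X)"
begin

abbreviation V where "V x \<equiv> (\<lambda>y. - Dx x y) ` Y"
abbreviation T where "T x \<equiv> direction_space (V x)"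
abbreviation Ai where "Ai x y \<equiv> matrix_inv (A x y)"
abbreviation ex where "ex \<equiv> cexp Dx Y"

section \<open>The c-exponential map and changes of base point\<close>

lemma ex_minus_Dx: "x \<in> X \<Longrightarrow> y \<in> Y \<Longrightarrow> ex x (- Dx x y) = y"
  unfolding cexp_def by (rule the_inv_into_f_f[OF twisted])

lemma ex_in: "x \<in> X \<Longrightarrow> v \<in> V x \<Longrightarrow> ex x v \<in> Y"
  by (auto simp: ex_minus_Dx)

lemma Ai_A: "x \<in> X \<Longrightarrow> y \<in> Y \<Longrightarrow> Ai x y *v (A x y *v h) = h"
  and A_Ai: "x \<in> X \<Longrightarrow> y \<in> Y \<Longrightarrow> A x y *v (Ai x y *v h) = h"
  by (simp_all add: matrix_inv_mult_vector nondeg)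

lemma has_derivative_ex:
  assumes "x \<in> X" "v \<in> V x"
  shows "(ex x has_derivative (\<lambda>h. - (Ai x (ex x v) *v h))) (at v within V x)"
proof -
  obtain y where y: "y \<in> Y" "v = - Dx x y" using assms by blast
  have "(the_inv_into Y (\<lambda>y. - Dx x y) has_derivative (\<lambda>h. - (Ai x y *v h))) (at (- Dx x y) within V x)"
    using assms y by (intro has_derivative_the_inv_into_minus compact_Y twisted Dxy nondeg)
  moreover have "ex x = the_inv_into Y (\<lambda>y. - Dx x y)" by (simp add: cexp_def fun_eq_iff)
  moreover have "ex x v = y" using assms y by (simp add: ex_minus_Dx)
  ultimately show ?thesis using y by simp
qed

text \<open>Change of coordinates on \<open>Y\<close> from \<open>V x0\<close> to
  \<open>V x\<close>; the two minus signs cancel.\<close>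

lemma has_derivative_transition:
  assumes "x \<in> X" "x0 \<in> X" "v \<in> V x0"
  shows "((\<lambda>v. - Dx x (ex x0 v)) has_derivative (\<lambda>h. A x (ex x0 v) *v (Ai x0 (ex x0 v) *v h)))
    (at v within V x0)"
proof -
  have "(Dx x has_derivative (\<lambda>h. A x (ex x0 v) *v h)) (at (ex x0 v) within ex x0 ` V x0)"
    using Dxy[OF assms(1) ex_in[OF assms(2,3)]] by (rule has_derivative_at_withinI)
  from has_derivative_minus[OF has_derivative_in_compose[OF has_derivative_ex[OF assms(2,3)] this]]
  show ?thesis by (simp add: linear_neg[OF matrix_vector_mul_linear])
qed

text \<open>Independence of \<^term>\<open>x\<close> of the tangent space of \<^term>\<open>Y\<close> at \<^term>\<open>y\<close>, which is
  \<^term>\<open>T x\<close> transported by \<^term>\<open>Ai x y\<close>; \<^term>\<open>Y\<close> need not have interior points.\<close>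

lemma direction_space_transport:
  assumes "x \<in> X" "x0 \<in> X" "y \<in> Y" "w \<in> T x0"
  shows "A x y *v (Ai x0 y *v w) \<in> T x"
proof (rule has_derivative_maps_direction_space[OF cdomconv[OF assms(2)] _ _ _ assms(4)])
  show v: "- Dx x0 y \<in> V x0" using assms by blast
  show "((\<lambda>v. - Dx x (ex x0 v)) has_derivative (\<lambda>h. A x y *v (Ai x0 y *v h))) (at (- Dx x0 y) within V x0)"
    using has_derivative_transition[OF assms(1,2) v] assms by (simp add: ex_minus_Dx)
  show "(\<lambda>v. - Dx x (ex x0 v)) ` V x0 \<subseteq> V x"
    using ex_in assms by blast
qed

text \<open>The segment in the convex image of \<open>X\<close> under \<open>- Dy _ y\<close> pulls
  back to a curve from \<open>x0\<close> to \<open>x\<close>. Along it the derivative of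
  \<open>Dy _ y'\<close> is linear in the constant velocity, so the difference at \<open>y'\<close>
  is expressed through the difference at \<open>y\<close>; this makes the later bounds
  relative.\<close>

lemma Dy_difference_mean_value:
  assumes "x \<in> X" "x0 \<in> X" "y \<in> Y" "y' \<in> Y"
  obtains \<xi> where "\<xi> \<in> X"
    "(Dy x y' - Dy x0 y') \<bullet> \<theta> = (Dy x y - Dy x0 y) \<bullet> (Ai \<xi> y *v (A \<xi> y' *v \<theta>))"
proof -
  define p where "p = Dy x y - Dy x0 y"
  define q where "q s = - Dy x0 y + s *\<^sub>R (- p)" for s :: real
  define e where "e = the_inv_into X (\<lambda>x. - Dy x y)"
  define \<xi> where "\<xi> s = e (q s)" for s
  let ?W = "(\<lambda>x. - Dy x y) ` X"
  have e: "e (- Dy z y) = z" if "z \<in> X" for z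
    unfolding e_def by (rule the_inv_into_f_f[OF twisted_star[OF assms(3)] that])
  have q: "q s \<in> ?W" if "s \<in> {0..1}" for s
    using convexD_alt[OF cdomconv_star[OF assms(3)], of "- Dy x0 y" "- Dy x y" s] assms that
    by (simp add: q_def p_def algebra_simps)
  have \<xi>X: "\<xi> s \<in> X" and \<xi>q: "- Dy (\<xi> s) y = q s" if "s \<in> {0..1}" for s
    using q[OF that] e by (auto simp: \<xi>_def)
  have e_der: "(e has_derivative (\<lambda>h. - (matrix_inv (transpose (A z y)) *v h))) (at (- Dy z y) within ?W)"
    if "z \<in> X" for z
    unfolding e_def using assms that
    by (intro has_derivative_the_inv_into_minus compact_X twisted_star Dyx transpose_invertible nondeg)
  have q_der: "(q has_derivative (\<lambda>h. h *\<^sub>R (- p))) (at s within {0..1})" for s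
    unfolding q_def by (auto intro!: derivative_eq_intros)
  have \<xi>_der: "(\<xi> has_derivative (\<lambda>h. h *\<^sub>R (matrix_inv (transpose (A (\<xi> s) y)) *v p))) (at s within {0..1})"
    if s: "s \<in> {0..1}" for s
  proof -
    have "(e has_derivative (\<lambda>h. - (matrix_inv (transpose (A (\<xi> s) y)) *v h))) (at (q s) within q ` {0..1})"
      using e_der[OF \<xi>X[OF s]] q unfolding \<xi>q[OF s] by (auto intro: has_derivative_subset)
    from has_derivative_in_compose[OF q_der this] show ?thesis
      unfolding \<xi>_def
      by (simp add: linear_neg[OF matrix_vector_mul_linear] linear_scale[OF matrix_vector_mul_linear])
  qed
  have "((\<lambda>s. Dy (\<xi> s) y' \<bullet> \<theta>) has_derivative
      (\<lambda>h. h * (p \<bullet> (Ai (\<xi> s) y *v (A (\<xi> s) y' *v \<theta>))))) (at s within {0..1})"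
    if s: "s \<in> {0..1}" for s
  proof -
    have "((\<lambda>x. Dy x y') has_derivative (\<lambda>h. transpose (A (\<xi> s) y') *v h)) (at (\<xi> s) within \<xi> ` {0..1})"
      using Dyx[OF \<xi>X[OF s] assms(4)] by (rule has_derivative_at_withinI)
    from has_derivative_inner_left[OF has_derivative_in_compose[OF \<xi>_der[OF s] this], of \<theta>]
    show ?thesis
      by (rule has_derivative_eq_rhs)
        (simp only: fun_eq_iff inner_transpose_mult_vector inner_scaleR_left
          inner_matrix_inv_transpose[OF nondeg[OF \<xi>X[OF s] assms(3)]], simp)
  qed
  \<comment> \<open>The mean value theorem needs a scalar function, hence the pairing with
    \<open>\<theta>\<close>, on which \<open>\<xi>\<close> depends.\<close>
  from mvt_very_simple[OF zero_le_one this] obtain s where s: "s \<in> {0..1}"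
    "Dy (\<xi> 1) y' \<bullet> \<theta> - Dy (\<xi> 0) y' \<bullet> \<theta> = p \<bullet> (Ai (\<xi> s) y *v (A (\<xi> s) y' *v \<theta>))"
    by auto
  have "\<xi> 0 = x0" "\<xi> 1 = x"
    using e assms by (simp_all add: \<xi>_def q_def p_def)
  then show thesis
    using that[OF \<xi>X[OF s(1)]] s(2) by (simp add: p_def inner_diff_left)
qed

section \<open>Bounds uniform over the compact domains\<close>

text \<open>\<open>m\<close> is the minimum of the norm of \<open>A x y *v h\<close> over
  \<open>X\<close>, \<open>Y\<close> and the unit sphere, positive by nondegeneracy;
  \<open>N\<close> and \<open>J\<close> come from compactness and the Lipschitz condition.\<close>

lemma hessian_bounds:
  obtains m N J where "0 < m" "0 \<le> N" "0 \<le> J"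
    "\<And>x y h. x \<in> X \<Longrightarrow> y \<in> Y \<Longrightarrow> norm (Ai x y *v h) \<le> norm h / m"
    "\<And>x y h. x \<in> X \<Longrightarrow> y \<in> Y \<Longrightarrow> norm (A x y *v h) \<le> N * norm h"
    "\<And>x y y' h. x \<in> X \<Longrightarrow> y \<in> Y \<Longrightarrow> y' \<in> Y \<Longrightarrow>
      norm ((A x y' - A x y) *v h) \<le> J * norm (y' - y) * norm h"
proof -
  obtain k where k: "k > 0" "\<And>(B::real^'n^'n) h. norm (B *v h) \<le> norm B * norm h * k"
    using bounded_bilinear.pos_bounded[OF bounded_bilinear_matrix_vector_mult] by blast
  obtain L where L: "L-lipschitz_on (X \<times> Y) (\<lambda>(x, y). A x y)" using lipschitz by blast
  have L0: "0 \<le> L" by (rule lipschitz_on_nonneg[OF L])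
  have cont: "continuous_on (X \<times> Y) (\<lambda>(x, y). A x y)" by (rule lipschitz_on_continuous_on[OF L])
  have "bounded ((\<lambda>(x, y). A x y) ` (X \<times> Y))"
    by (intro compact_imp_bounded compact_continuous_image cont compact_Times compact_X compact_Y)
  then obtain a where a: "a > 0" "\<And>x y. x \<in> X \<Longrightarrow> y \<in> Y \<Longrightarrow> norm (A x y) \<le> a"
    unfolding bounded_pos by fastforce
  have N: "norm (A x y *v h) \<le> a * k * norm h" if "x \<in> X" "y \<in> Y" for x y h
  proof -
    have "norm (A x y *v h) \<le> norm (A x y) * norm h * k" by (rule k)
    also have "\<dots> \<le> a * norm h * k" using a that k by (intro mult_right_mono) auto
    finally show ?thesis by (simp add: mult.commute mult.left_commute)
  qed
  have J: "norm ((A x y' - A x y) *v h) \<le> L * k * norm (y' - y) * norm h"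
    if "x \<in> X" "y \<in> Y" "y' \<in> Y" for x y y' h
  proof -
    have "norm (A x y' - A x y) \<le> L * norm (y' - y)"
      using lipschitz_onD[OF L, of "(x, y')" "(x, y)"] that by (simp add: dist_norm dist_Pair_Pair)
    then have "norm (A x y' - A x y) * norm h * k \<le> (L * norm (y' - y)) * norm h * k"
      using k by (intro mult_right_mono) auto
    from order_trans[OF k(2) this] show ?thesis by (simp add: ac_simps)
  qed
  obtain m where m: "m > 0" "\<And>x y h. x \<in> X \<Longrightarrow> y \<in> Y \<Longrightarrow> norm h = 1 \<Longrightarrow> m \<le> norm (A x y *v h)"
  proof -
    let ?S = "(X \<times> Y) \<times> sphere (0::real^'n) 1"
    let ?f = "\<lambda>z. norm ((\<lambda>(x, y). A x y) (fst z) *v snd z)"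
    show thesis
    proof (cases "?S = {}")
      case True
      then show ?thesis by (intro that[of 1]) (auto simp: dist_norm)
    next
      case False
      have "continuous_on ?S (\<lambda>z. (\<lambda>(x, y). A x y) (fst z))"
        by (rule continuous_on_compose2[OF cont]) (auto intro: continuous_intros)
      then have "continuous_on ?S ?f"
        by (intro continuous_on_norm bounded_bilinear.continuous_on[OF bounded_bilinear_matrix_vector_mult]
            continuous_on_snd continuous_on_id)
      moreover have "compact ?S" by (intro compact_Times compact_X compact_Y compact_sphere)
      ultimately obtain z where z: "z \<in> ?S" "\<And>z'. z' \<in> ?S \<Longrightarrow> ?f z \<le> ?f z'"
        using continuous_attains_inf[of ?S ?f] False by blast
      obtain x y h where xyh: "z = ((x, y), h)" by (metis prod.exhaust)
      have "?f z \<noteq> 0"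
        using z(1) Ai_A[of x y h] by (auto simp: xyh)
      then have "?f z > 0" by simp
      moreover have "?f z \<le> norm (A x y *v h)" if "x \<in> X" "y \<in> Y" "norm h = 1" for x y h
        using z(2)[of "((x, y), h)"] that by simp
      ultimately show ?thesis using that[of "?f z"] by blast
    qed
  qed
  have mA: "m * norm h \<le> norm (A x y *v h)" if "x \<in> X" "y \<in> Y" for x y h
  proof (cases "h = 0")
    case False
    have "m \<le> norm (A x y *v ((1 / norm h) *\<^sub>R h))" using False that by (intro m) auto
    also have "\<dots> = norm (A x y *v h) / norm h"
      by (simp add: linear_scale[OF matrix_vector_mul_linear])
    finally show ?thesis using False by (simp add: field_simps)
  qed simp
  have Ai_bound: "norm (Ai x y *v h) \<le> norm h / m" if "x \<in> X" "y \<in> Y" for x y h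
    using mA[OF that, of "Ai x y *v h"] m(1) by (simp add: A_Ai that field_simps)
  show thesis
    using that[OF m(1) _ _ Ai_bound N J] a k L0 by simp
qed

lemma ex_lipschitz:
  assumes "\<And>y h. y \<in> Y \<Longrightarrow> norm (Ai x y *v h) \<le> norm h / m"
    and "x \<in> X" "v \<in> V x" "v' \<in> V x"
  shows "norm (ex x v' - ex x v) \<le> norm (v' - v) / m"
proof -
  have "norm (ex x v' - ex x v) \<le> (1 / m) * norm (v' - v)"
  proof (rule differentiable_bound[OF cdomconv[OF assms(2)] has_derivative_ex[OF assms(2)]])
    show "onorm (\<lambda>h. - (Ai x (ex x u) *v h)) \<le> 1 / m" if "u \<in> V x" for u
      using assms(1)[OF ex_in[OF assms(2) that]] by (intro onorm_le) simp
  qed (use assms in auto)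
  then show ?thesis by simp
qed

text \<open>Continuity of \<open>Dx\<close> in its first argument is not assumed, so compactness
  bounds \<open>V x0\<close> for one fixed \<open>x0\<close>. Every other \<open>V x\<close> is its
  image under the transition map, which has Lipschitz constant \<open>N / m\<close>.\<close>

lemma uniform_diameter:
  obtains R where "\<And>x u v. x \<in> X \<Longrightarrow> u \<in> V x \<Longrightarrow> v \<in> V x \<Longrightarrow> norm (u - v) \<le> R"
proof (cases "X = {}")
  case False
  then obtain x0 where x0: "x0 \<in> X" by blast
  obtain m N where mN: "0 < m" "0 \<le> N"
    "\<And>x y h. x \<in> X \<Longrightarrow> y \<in> Y \<Longrightarrow> norm (Ai x y *v h) \<le> norm h / m"
    "\<And>x y h. x \<in> X \<Longrightarrow> y \<in> Y \<Longrightarrow> norm (A x y *v h) \<le> N * norm h"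
    by (rule hessian_bounds) blast
  have "continuous_on Y (\<lambda>y. - Dx x0 y)"
    using has_derivative_continuous[OF has_derivative_at_withinI[OF Dxy[OF x0]]]
    by (intro continuous_on_minus) (auto simp: continuous_on_eq_continuous_within)
  then have bdd: "bounded (V x0)"
    by (intro compact_imp_bounded compact_continuous_image compact_Y)
  have "norm (u - v) \<le> N / m * diameter (V x0)" if x: "x \<in> X" and uv: "u \<in> V x" "v \<in> V x" for x u v
  proof -
    obtain y y' where y: "y \<in> Y" "y' \<in> Y" "u = - Dx x y" "v = - Dx x y'" using uv by blast
    let ?f = "\<lambda>v. - Dx x (ex x0 v)"
    have "norm (?f (- Dx x0 y) - ?f (- Dx x0 y')) \<le> N / m * norm ((- Dx x0 y) - (- Dx x0 y'))"
    proof (rule differentiable_bound[OF cdomconv[OF x0] has_derivative_transition[OF x x0]])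
      fix u assume "u \<in> V x0"
      then have uY: "ex x0 u \<in> Y" by (rule ex_in[OF x0])
      show "onorm (\<lambda>h. A x (ex x0 u) *v (Ai x0 (ex x0 u) *v h)) \<le> N / m"
      proof (rule onorm_le)
        fix h
        have "norm (A x (ex x0 u) *v (Ai x0 (ex x0 u) *v h)) \<le> N * norm (Ai x0 (ex x0 u) *v h)"
          by (rule mN(4)[OF x uY])
        also have "\<dots> \<le> N * (norm h / m)" by (rule mult_left_mono[OF mN(3)[OF x0 uY] mN(2)])
        finally show "norm (A x (ex x0 u) *v (Ai x0 (ex x0 u) *v h)) \<le> N / m * norm h" by simp
      qed
    qed (use y in auto)
    also have "\<dots> \<le> N / m * diameter (V x0)"
      using mN y diameter_bounded_bound[OF bdd, of "- Dx x0 y" "- Dx x0 y'"]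
      by (intro mult_left_mono) (auto simp: dist_norm)
    finally show ?thesis using y x0 by (simp add: ex_minus_Dx)
  qed
  then show ?thesis by (rule that)
qed (use that in blast)

section \<open>Gradient of the cost difference and its control\<close>

lemma has_derivative_cost_difference:
  assumes "x \<in> X" "x0 \<in> X" "v \<in> V x0"
  shows "((\<lambda>v. - c x (ex x0 v) + c x0 (ex x0 v)) has_derivative
    (\<lambda>h. (Dy x (ex x0 v) - Dy x0 (ex x0 v)) \<bullet> (Ai x0 (ex x0 v) *v h))) (at v within V x0)"
proof -
  have *: "((\<lambda>v. c z (ex x0 v)) has_derivative (\<lambda>h. Dy z (ex x0 v) \<bullet> - (Ai x0 (ex x0 v) *v h)))
    (at v within V x0)" if "z \<in> X" for z
    by (rule has_derivative_in_compose[OF has_derivative_ex[OF assms(2,3)]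
          has_derivative_at_withinI[OF Dy[OF that ex_in[OF assms(2,3)]]]])
  show ?thesis
    using has_derivative_add[OF has_derivative_minus[OF *[OF assms(1)]] *[OF assms(2)]]
    by (rule has_derivative_eq_rhs) (simp add: fun_eq_iff inner_diff_left)
qed

text \<open>Written with the mean value theorem along a segment of \<^term>\<open>(\<lambda>x. - Dy x y) ` X\<close>, the
  difference of the gradients at two points is the gradient at one of them, tested against a
  tangent vector \<^term>\<open>\<omega>\<close> that is small by the Lipschitz condition.\<close>

lemma gradient_difference_bound:
  assumes m: "0 < m" and N: "0 \<le> N" and J: "0 \<le> J"
    and Ai: "\<And>x y h. x \<in> X \<Longrightarrow> y \<in> Y \<Longrightarrow> norm (Ai x y *v h) \<le> norm h / m"
    and A: "\<And>x y h. x \<in> X \<Longrightarrow> y \<in> Y \<Longrightarrow> norm (A x y *v h) \<le> N * norm h"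
    and A_diff: "\<And>x y y' h. x \<in> X \<Longrightarrow> y \<in> Y \<Longrightarrow> y' \<in> Y \<Longrightarrow>
      norm ((A x y' - A x y) *v h) \<le> J * norm (y' - y) * norm h"
    and x: "x \<in> X" "x0 \<in> X" and v: "v \<in> V x0" "v' \<in> V x0"
    and G: "\<And>v. v \<in> V x0 \<Longrightarrow> G v \<in> T x0"
    and Gw: "\<And>v w. v \<in> V x0 \<Longrightarrow> w \<in> T x0 \<Longrightarrow>
      G v \<bullet> w = (Dy x (ex x0 v) - Dy x0 (ex x0 v)) \<bullet> (Ai x0 (ex x0 v) *v w)"
  shows "norm (G v' - G v) \<le> 2 * N * J / m ^ 3 * norm (v' - v) * norm (G v)"
proof -
  define y y' where "y = ex x0 v" and "y' = ex x0 v'"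
  have y: "y \<in> Y" "y' \<in> Y" using v x by (auto simp: y_def y'_def ex_in)
  \<comment> \<open>The gradient difference is tested against itself; \<open>a\<close> is
    \<open>w\<close> carried to the point \<open>y'\<close>.\<close>
  define w where "w = G v' - G v"
  define p where "p = Dy x y - Dy x0 y"
  define a where "a = Ai x0 y' *v w"
  have wT: "w \<in> T x0"
    unfolding w_def using G v by (intro subspace_diff subspace_direction_space) auto
  obtain \<xi> where \<xi>: "\<xi> \<in> X"
    "(Dy x y' - Dy x0 y') \<bullet> a = p \<bullet> (Ai \<xi> y *v (A \<xi> y' *v a))"
    using Dy_difference_mean_value[OF x y] unfolding p_def by blast
  \<comment> \<open>Chosen so that \<open>w \<bullet> w = p \<bullet> \<theta>\<close>; it vanishes
    for \<open>y' = y\<close>. Its transport \<open>\<omega>\<close> is tangent, which turns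
    \<open>p \<bullet> \<theta>\<close> into \<open>G v \<bullet> \<omega>\<close>.\<close>
  define \<theta> where "\<theta> = Ai \<xi> y *v (A \<xi> y' *v a) - Ai x0 y *v w"
  define \<omega> where "\<omega> = A x0 y *v \<theta>"
  have "A x0 y *v (Ai \<xi> y *v (A \<xi> y' *v a)) \<in> T x0"
    unfolding a_def using x \<xi> y wT by (intro direction_space_transport)
  then have \<omega>T: "\<omega> \<in> T x0"
    unfolding \<omega>_def \<theta>_def using wT x y
    by (auto simp: matrix_vector_mult_diff_distrib A_Ai intro!: subspace_diff subspace_direction_space)
  have "w \<bullet> w = G v' \<bullet> w - G v \<bullet> w" by (simp add: w_def inner_diff_left)
  also have "\<dots> = p \<bullet> \<theta>"
    using Gw[OF v(2) wT] Gw[OF v(1) wT] \<xi>(2)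
    by (simp add: y_def[symmetric] y'_def[symmetric] p_def \<theta>_def a_def inner_diff_right)
  also have "\<dots> = G v \<bullet> \<omega>"
    using Gw[OF v(1) \<omega>T] x y by (simp add: y_def[symmetric] p_def \<omega>_def Ai_A)
  also have "\<dots> \<le> norm (G v) * norm \<omega>" by (rule norm_cauchy_schwarz)
  finally have ww: "norm w * norm w \<le> norm (G v) * norm \<omega>"
    by (simp add: power2_eq_square[symmetric] power2_norm_eq_inner)
  define b where "b = J * norm (y' - y) * norm a"
  \<comment> \<open>Subtracting \<open>a\<close> from both terms of \<open>\<theta>\<close>, with
    \<open>w = A x0 y' *v a\<close>, exhibits Hessian differences between \<open>y\<close> and
    \<open>y'\<close>.\<close>
  have "\<theta> = Ai \<xi> y *v ((A \<xi> y' - A \<xi> y) *v a) - Ai x0 y *v ((A x0 y' - A x0 y) *v a)"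
    using x y \<xi>
    by (simp add: \<theta>_def a_def matrix_vector_mult_diff_distrib matrix_vector_mult_diff_rdistrib Ai_A A_Ai)
  then have "norm \<theta> \<le> norm (Ai \<xi> y *v ((A \<xi> y' - A \<xi> y) *v a)) + norm (Ai x0 y *v ((A x0 y' - A x0 y) *v a))"
    using norm_triangle_ineq4 by metis
  also have "\<dots> \<le> b / m + b / m"
    unfolding b_def using m x y \<xi>
    by (intro add_mono order_trans[OF Ai] divide_right_mono A_diff) auto
  finally have \<theta>: "norm \<theta> \<le> 2 * b / m" by simp
  have "norm (y' - y) \<le> norm (v' - v) / m"
    unfolding y_def y'_def using ex_lipschitz[OF Ai] x v by blast
  moreover have "norm a \<le> norm w / m" unfolding a_def using Ai x y by blast
  ultimately have b: "b \<le> J * (norm (v' - v) / m) * (norm w / m)"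
    unfolding b_def using J m by (intro mult_mono mult_left_mono) auto
  \<comment> \<open>The three factors \<open>1 / m\<close> stem from \<open>Ai\<close> in
    \<open>\<theta>\<close>, the Lipschitz bound for \<open>ex x0\<close>, and the norm of
    \<open>a\<close>.\<close>
  have "norm \<omega> \<le> N * norm \<theta>" unfolding \<omega>_def using A x y by blast
  also have "\<dots> \<le> N * (2 * (J * (norm (v' - v) / m) * (norm w / m)) / m)"
    using b m N by (intro mult_left_mono order_trans[OF \<theta>] divide_right_mono) auto
  also have "\<dots> = 2 * N * J / m ^ 3 * norm (v' - v) * norm w"
    by (simp add: power3_eq_cube)
  finally have "norm (G v) * norm \<omega> \<le> norm (G v) * (2 * N * J / m ^ 3 * norm (v' - v) * norm w)"
    by (intro mult_left_mono) auto
  with ww have "norm w * norm w \<le> (2 * N * J / m ^ 3 * norm (v' - v) * norm (G v)) * norm w"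
    by (simp add: ac_simps)
  moreover have "0 \<le> 2 * N * J / m ^ 3 * norm (v' - v) * norm (G v)"
    using m N J by simp
  ultimately show ?thesis
    unfolding w_def[symmetric] by (cases "w = 0") (simp, meson mult_right_le_imp_le zero_less_norm_iff)
qed

section \<open>From Loeper's condition to QQconv\<close>

lemma loeper_imp_gradient_controlled_quasiconvex:
  assumes "loeper c Dx X Y"
  obtains K R where "\<And>x x0. x \<in> X \<Longrightarrow> x0 \<in> X \<Longrightarrow>
    \<exists>G. gradient_controlled_quasiconvex (V x0) (\<lambda>v. - c x (ex x0 v) + c x0 (ex x0 v)) G K R"
proof -
  obtain m N J where bounds: "0 < m" "0 \<le> N" "0 \<le> J"
    "\<And>x y h. x \<in> X \<Longrightarrow> y \<in> Y \<Longrightarrow> norm (Ai x y *v h) \<le> norm h / m"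
    "\<And>x y h. x \<in> X \<Longrightarrow> y \<in> Y \<Longrightarrow> norm (A x y *v h) \<le> N * norm h"
    "\<And>x y y' h. x \<in> X \<Longrightarrow> y \<in> Y \<Longrightarrow> y' \<in> Y \<Longrightarrow>
      norm ((A x y' - A x y) *v h) \<le> J * norm (y' - y) * norm h"
    by (rule hessian_bounds) blast
  obtain R where R: "\<And>x u v. x \<in> X \<Longrightarrow> u \<in> V x \<Longrightarrow> v \<in> V x \<Longrightarrow> norm (u - v) \<le> R"
    by (rule uniform_diameter) blast
  have "\<exists>G. gradient_controlled_quasiconvex (V x0) (\<lambda>v. - c x (ex x0 v) + c x0 (ex x0 v)) G (2 * N * J / m ^ 3) R"
    if x: "x \<in> X" "x0 \<in> X" for x x0
  proof -
    let ?f' = "\<lambda>v h. (Dy x (ex x0 v) - Dy x0 (ex x0 v)) \<bullet> (Ai x0 (ex x0 v) *v h)"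
    \<comment> \<open>The projection of the full gradient to \<open>T x0\<close>. It exists for
      every \<open>v\<close>, also outside \<open>V x0\<close>, so a total function \<open>G\<close>
      can be chosen.\<close>
    have "\<exists>g. g \<in> T x0 \<and> (\<forall>w\<in>T x0. g \<bullet> w = ?f' v w)" for v
    proof -
      let ?g = "transpose (Ai x0 (ex x0 v)) *v (Dy x (ex x0 v) - Dy x0 (ex x0 v))"
      obtain g z where gz: "g \<in> T x0" "\<And>w. w \<in> T x0 \<Longrightarrow> orthogonal z w" "?g = g + z"
        unfolding direction_space_def by (rule orthogonal_subspace_decomp_exists[where x = ?g]) blast
      have "g \<bullet> w = ?f' v w" if "w \<in> T x0" for w
        using gz(2)[OF that] inner_transpose_mult_vector[of "Ai x0 (ex x0 v)" _ w]
        by (metis gz(3) inner_add_left orthogonal_def add.right_neutral)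
      then show ?thesis using gz(1) by blast
    qed
    then obtain G where G: "\<And>v. G v \<in> T x0" "\<And>v w. w \<in> T x0 \<Longrightarrow> G v \<bullet> w = ?f' v w"
      by metis
    have "gradient_controlled_quasiconvex (V x0) (\<lambda>v. - c x (ex x0 v) + c x0 (ex x0 v)) G (2 * N * J / m ^ 3) R"
    proof
      show "((\<lambda>v. - c x (ex x0 v) + c x0 (ex x0 v)) has_derivative (\<lambda>h. G v \<bullet> h)) (at v within V x0)"
        if "v \<in> V x0" for v
        by (rule has_derivative_within_cong_directions[OF has_derivative_cost_difference[OF x that]
              bounded_linear_inner_right that]) (rule G)
      show "norm (G u - G v) \<le> 2 * N * J / m ^ 3 * norm (u - v) * norm (G v)"
        if "u \<in> V x0" "v \<in> V x0" for u v
        by (rule gradient_difference_bound[OF bounds x that(2,1) G]) assumption+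
      show "- c x (ex x0 ((1 - t) *\<^sub>R u + t *\<^sub>R v)) + c x0 (ex x0 ((1 - t) *\<^sub>R u + t *\<^sub>R v))
          \<le> max (- c x (ex x0 u) + c x0 (ex x0 u)) (- c x (ex x0 v) + c x0 (ex x0 v))"
        if "u \<in> V x0" "v \<in> V x0" "t \<in> {0..1}" for u v t
      proof -
        have "f_t c Dx Y x0 u v t x \<le> max (f_t c Dx Y x0 u v 1 x) (f_t c Dx Y x0 u v 0 x)"
          using assms x that unfolding loeper_def by blast
        then show ?thesis by (simp add: f_t_def Let_def max.commute)
      qed
      show "0 \<le> 2 * N * J / m ^ 3" using bounds(1-3) by simp
      show "norm (u - v) \<le> R" if "u \<in> V x0" "v \<in> V x0" for u v
        by (rule R[OF x(2) that])
    qed (use cdomconv x G in auto)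
    then show ?thesis by blast
  qed
  then show thesis by (rule that)
qed

theorem loeper_imp_QQconv:
  assumes "loeper c Dx X Y"
  shows "QQconv c Dx X Y"
proof -
  obtain K R where KR: "\<And>x x0. x \<in> X \<Longrightarrow> x0 \<in> X \<Longrightarrow>
    \<exists>G. gradient_controlled_quasiconvex (V x0) (\<lambda>v. - c x (ex x0 v) + c x0 (ex x0 v)) G K R"
    using loeper_imp_gradient_controlled_quasiconvex[OF assms] by blast
  \<comment> \<open>The maximum secures \<open>M \<ge> 1\<close> even for empty \<open>X\<close>,
    where nothing is known about \<open>K\<close> and \<open>R\<close>.\<close>
  define M where "M = max 1 (2 * exp (2 * gradient_controlled_quasiconvex.decay K R))"
  have "f_t c Dx Y x0 v0 v1 t x - f_t c Dx Y x0 v0 v1 0 x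
      \<le> M * t * max (f_t c Dx Y x0 v0 v1 1 x - f_t c Dx Y x0 v0 v1 0 x) 0"
    if x: "x \<in> X" "x0 \<in> X" and v: "v0 \<in> V x0" "v1 \<in> V x0" and t: "t \<in> {0..1}" for x x0 v0 v1 t
  proof -
    obtain G where "gradient_controlled_quasiconvex (V x0) (\<lambda>v. - c x (ex x0 v) + c x0 (ex x0 v)) G K R"
      using KR[OF x] by blast
    then interpret gradient_controlled_quasiconvex "V x0" "\<lambda>v. - c x (ex x0 v) + c x0 (ex x0 v)" G K R .
    have seg: "v0 + t *\<^sub>R (v1 - v0) = (1 - t) *\<^sub>R v0 + t *\<^sub>R v1" by (simp add: algebra_simps)
    let ?d = "max (f_t c Dx Y x0 v0 v1 1 x - f_t c Dx Y x0 v0 v1 0 x) 0"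
    have "f_t c Dx Y x0 v0 v1 t x - f_t c Dx Y x0 v0 v1 0 x \<le> 2 * exp (2 * decay) * t * ?d"
      using quantitative_quasiconvexity[OF v t] unfolding seg by (simp add: f_t_def Let_def)
    also have "\<dots> \<le> M * t * ?d"
      using t by (intro mult_right_mono) (auto simp: M_def)
    finally show ?thesis .
  qed
  moreover have "1 \<le> M" by (simp add: M_def)
  ultimately show ?thesis unfolding QQconv_def by blast
qed

end

theorem mainTheorem1:
  fixes X Y :: "(real^'n) set"
    and c :: "real^'n \<Rightarrow> real^'n \<Rightarrow> real"
    and Dx Dy :: "real^'n \<Rightarrow> real^'n \<Rightarrow> real^'n"
    and Dxy Dyx :: "real^'n \<Rightarrow> real^'n \<Rightarrow> real^'n^'n"
  assumes "compact X" and "compact Y"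
    and meas: "(\<lambda>(x, y). c x y) \<in> borel_measurable (restrict_space borel (X \<times> Y))"
    and Dx: "\<And>x y. x \<in> X \<Longrightarrow> y \<in> Y \<Longrightarrow> ((\<lambda>x'. c x' y) has_derivative (\<lambda>h. Dx x y \<bullet> h)) (at x)"
    and Dy: "\<And>x y. x \<in> X \<Longrightarrow> y \<in> Y \<Longrightarrow> ((\<lambda>y'. c x y') has_derivative (\<lambda>h. Dy x y \<bullet> h)) (at y)"
    and Dxy: "\<And>x y. x \<in> X \<Longrightarrow> y \<in> Y \<Longrightarrow> ((\<lambda>y'. Dx x y') has_derivative (\<lambda>h. Dxy x y *v h)) (at y)"
    and Dyx: "\<And>x y. x \<in> X \<Longrightarrow> y \<in> Y \<Longrightarrow> ((\<lambda>x'. Dy x' y) has_derivative (\<lambda>h. Dyx x y *v h)) (at x)"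
    and sym: "\<And>x y. x \<in> X \<Longrightarrow> y \<in> Y \<Longrightarrow> transpose (Dxy x y) = Dyx x y"
    and twisted: "\<And>x. x \<in> X \<Longrightarrow> inj_on (\<lambda>y. - Dx x y) Y"
    and twisted_star: "\<And>y. y \<in> Y \<Longrightarrow> inj_on (\<lambda>x. - Dy x y) X"
    and nondeg: "\<And>x y. x \<in> X \<Longrightarrow> y \<in> Y \<Longrightarrow> invertible (Dxy x y)"
    and lip: "\<exists>L. L-lipschitz_on (X \<times> Y) (\<lambda>(x, y). Dxy x y)"
    and cdomconv: "\<And>x. x \<in> X \<Longrightarrow> convex ((\<lambda>y. - Dx x y) ` Y)"
    and cdomconv_star: "\<And>y. y \<in> Y \<Longrightarrow> convex ((\<lambda>x. - Dy x y) ` X)"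
    and "loeper c Dx X Y"
  shows "QQconv c Dx X Y"
proof -
  have "((\<lambda>x'. Dy x' y) has_derivative (\<lambda>h. transpose (Dxy x y) *v h)) (at x)"
    if "x \<in> X" "y \<in> Y" for x y
    unfolding sym[OF that] by (rule Dyx[OF that])
  then interpret twisted_cost X Y c Dx Dy Dxy
    using assms by unfold_locales simp_all
  show ?thesis by (rule loeper_imp_QQconv) fact
qed

end
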